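(* Suppose the set-valued operator $A:\mathbb{R}^n\rightrightarrows\mathbb{R}^n$ is locally monotone around $\bar x$ and partly smooth at $\bar x$ relative to a $C^p$-manifold $\mathcal{M}\subset\mathbb{R}^n$ ($p\ge1$). Let $\bar u\in\operatorname{rbd}(A(\bar x))$, let $\gamma>0$, and let $\varepsilon>0$ be small enough that $A$ is monotone over $B_\varepsilon(\bar x)$. Then there exists an enlarged manifold $\widehat{\mathcal{M}}$ for $\bar u$ such that $$\widehat{\mathcal{U}}_\gamma=\bigcup_{x\in\widehat{\mathcal{M}}\cap B_\varepsilon(\bar x)}\bigl(x+\gamma A(x)\bigr)$$ has full dimension, i.e. its linear span is $\mathbb{R}^n$. If, moreover, $A$ is continuous at $\bar x$ relative to $\widehat{\mathcal{M}}$, then $\widehat{\mathcal{M}}$ is identifiable at $\bar x$ for $\bar u$.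
   Context: Notation. $B_\varepsilon(\bar x)=\{x:\|x-\bar x\|<\varepsilon\}$. $\operatorname{rbd}$ denotes relative boundary. For a convex set $S$, $\operatorname{Lin}(S)=\operatorname{Aff}(S)-x$ ($x\in S$) is the linear subspace parallel to the affine hull of $S$. $T_{\mathcal{M}}(x)$, $N_{\mathcal{M}}(x)$ are the tangent and normal spaces of the manifold $\mathcal{M}$ at $x\in\mathcal{M}$; $P_V$ is the orthogonal projection onto $V$. $A$ is locally monotone around $\bar x$ if $\langle x-y,u-v\rangle\ge0$ for all $x,y$ in some ball around $\bar x$ and all $u\in A(x)$, $v\in A(y)$. Semicontinuity. $A$ is lower semi-continuous at $\bar x$ if for every $\bar u\in A(\bar x)$ and every sequence $x^{(k)}\in\operatorname{dom}A$ with $x^{(k)}\to\bar x$ there are $u^{(k)}\in A(x^{(k)})$ with $u^{(k)}\to\bar u$. $A$ is upper semi-continuous at $\bar x$ if $x^{(k)}\to\bar x$, $u^{(k)}\in A(x^{(k)})$, $u^{(k)}\to\bar u$ imply $\bar u\in A(\bar x)$. $A$ is upper semi-continuous if it is so at every point of its domain. Continuous along (relative to) a manifold means both lower and upper semi-continuous with sequences restricted to that manifold. Partly smooth operator. $A$ is partly smooth at $\bar x$ relative to a set $\mathcal{M}\ni\bar x$ if $\mathcal{M}$ is a $C^p$-manifold around $\bar x$, $A$ is upper semi-continuous, and: (Regularity) for every $x$ close to $\bar x$, $A(x)$ is nonempty, closed and convex; (Sharpness) $N_{\mathcal{M}}(\bar x)=\operatorname{Lin}(A(\bar x))$, and $x\mapsto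 P_{T_{\mathcal{M}}(x)}(A(x))$ is single-valued and continuous around $\bar x$ along $\mathcal{M}$; (Continuity) $A$ is continuous along $\mathcal{M}$ near $\bar x$. Enlarged manifold. For $\bar u\in\operatorname{rbd}(A(\bar x))$, put $\bar z=\bar x+\gamma\bar u$. An enlarged manifold for $\bar u$ is a manifold $\widehat{\mathcal{M}}\subset\mathbb{R}^n$ of smallest dimension among all manifolds $\mathcal{M}'\subset\mathbb{R}^n$ with $\mathcal{M}\subseteq\mathcal{M}'$ and $\bar z\in\operatorname{int}\bigl(\bigcup_{x\in\mathcal{M}'\cap B_\varepsilon(\bar x)}(x+\gamma A(x))\bigr)$. Identifiability. A manifold $\widehat{\mathcal{M}}\ni\bar x$ is identifiable at $\bar x$ for $\bar u\in A(\bar x)$ if for all sequences $x^{(k)}\to\bar x$ and $u^{(k)}\in A(x^{(k)})$ with $u^{(k)}\to\bar u$, one has $x^{(k)}\in\widehat{\mathcal{M}}$ for all $k$ large enough. *)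

theory Defs
  imports "HOL-Analysis.Analysis"
begin

section \<open>Maps and submanifolds of class C^p\<close>

text \<open>\<open>S\<close> is meant to be open. The order of differentiability can be counted through directional
  derivatives, because each step also demands total differentiability.\<close>

primrec Ck_on :: "nat \<Rightarrow> ('a::real_normed_vector \<Rightarrow> 'b::real_normed_vector) \<Rightarrow> 'a set \<Rightarrow> bool" where
  "Ck_on 0 f S \<longleftrightarrow> continuous_on S f"
| "Ck_on (Suc k) f S \<longleftrightarrow>
     (\<forall>x\<in>S. f differentiable (at x)) \<and> (\<forall>v. Ck_on k (\<lambda>x. frechet_derivative f (at x) v) S)"

text \<open>Embedded submanifolds without boundary, of pure dimension \<open>d\<close>, given by charts that straighten
  the ambient space. They need not be closed or connected.\<close>

definition Ck_submanifold :: "nat \<Rightarrow> nat \<Rightarrow> 'a::euclidean_space set \<Rightarrow> bool" where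
  "Ck_submanifold p d M \<longleftrightarrow>
     (\<forall>x\<in>M. \<exists>U V \<phi> \<psi> (L :: 'a set). open U \<and> x \<in> U \<and> open V \<and> homeomorphism U V \<phi> \<psi> \<and>
        Ck_on p \<phi> U \<and> Ck_on p \<psi> V \<and> subspace L \<and> dim L = d \<and> \<phi> ` (M \<inter> U) = V \<inter> L)"

definition Ck_submanifold_around :: "nat \<Rightarrow> 'a::euclidean_space set \<Rightarrow> 'a \<Rightarrow> bool" where
  "Ck_submanifold_around p M x \<longleftrightarrow>
     x \<in> M \<and> (\<exists>U d. open U \<and> x \<in> U \<and> Ck_submanifold p d (M \<inter> U))"

definition tangent_space :: "'a::euclidean_space set \<Rightarrow> 'a \<Rightarrow> 'a set" where
  "tangent_space M x =
     {v. \<exists>c e. e > 0 \<and> Ck_on 1 c {-e<..<e} \<and> c ` {-e<..<e} \<subseteq> M \<and> c (0::real) = x \<and>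
           (c has_vector_derivative v) (at 0)}"

definition normal_space :: "'a::euclidean_space set \<Rightarrow> 'a \<Rightarrow> 'a set" where
  "normal_space M x = orthogonal_comp (tangent_space M x)"

text \<open>\<open>Lin(S) = Aff(S) - x\<close> does not depend on the base point \<open>x \<in> S\<close>, so collecting over all of
  them gives the same set and avoids a choice.\<close>

definition Lin :: "'a::euclidean_space set \<Rightarrow> 'a set" where
  "Lin S = {y - x | y x. y \<in> affine hull S \<and> x \<in> S}"

section \<open>Set-valued operators\<close>

definition monotone_op_on :: "('a::euclidean_space \<Rightarrow> 'a set) \<Rightarrow> 'a set \<Rightarrow> bool" where
  "monotone_op_on A S \<longleftrightarrow>
     (\<forall>x\<in>S. \<forall>y\<in>S. \<forall>u\<in>A x. \<forall>v\<in>A y. inner (x - y) (u - v) \<ge> 0)"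

definition locally_monotone_op :: "('a::euclidean_space \<Rightarrow> 'a set) \<Rightarrow> 'a \<Rightarrow> bool" where
  "locally_monotone_op A x \<longleftrightarrow> (\<exists>e>0. monotone_op_on A (ball x e))"

definition op_dom :: "('a \<Rightarrow> 'b set) \<Rightarrow> 'a set" where
  "op_dom A = {x. A x \<noteq> {}}"

text \<open>Semicontinuity along sequences in \<open>S\<close>; the unrestricted notions are those with \<open>S = UNIV\<close>.
  The upper notion is sequential closedness of the graph (outer semicontinuity), not the
  upper semicontinuity of correspondences in terms of open neighbourhoods.\<close>

definition lsc_op_rel :: "('a::topological_space \<Rightarrow> 'b::topological_space set) \<Rightarrow> 'a set \<Rightarrow> 'a \<Rightarrow> bool" where
  "lsc_op_rel A S x \<longleftrightarrow>
     (\<forall>u\<in>A x. \<forall>X. (\<forall>k. X k \<in> op_dom A \<inter> S) \<longrightarrow> X \<longlonglongrightarrow> x \<longrightarrow>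
        (\<exists>U. (\<forall>k. U k \<in> A (X k)) \<and> U \<longlonglongrightarrow> u))"

definition usc_op_rel :: "('a::topological_space \<Rightarrow> 'b::topological_space set) \<Rightarrow> 'a set \<Rightarrow> 'a \<Rightarrow> bool" where
  "usc_op_rel A S x \<longleftrightarrow>
     (\<forall>X U u. (\<forall>k. X k \<in> S) \<longrightarrow> X \<longlonglongrightarrow> x \<longrightarrow> (\<forall>k. U k \<in> A (X k)) \<longrightarrow> U \<longlonglongrightarrow> u \<longrightarrow> u \<in> A x)"

definition continuous_op_rel :: "('a::topological_space \<Rightarrow> 'b::topological_space set) \<Rightarrow> 'a set \<Rightarrow> 'a \<Rightarrow> bool" where
  "continuous_op_rel A S x \<longleftrightarrow> lsc_op_rel A S x \<and> usc_op_rel A S x"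

definition usc_op :: "('a::topological_space \<Rightarrow> 'b::topological_space set) \<Rightarrow> bool" where
  "usc_op A \<longleftrightarrow> (\<forall>x\<in>op_dom A. usc_op_rel A UNIV x)"

definition partly_smooth_op :: "nat \<Rightarrow> ('a::euclidean_space \<Rightarrow> 'a set) \<Rightarrow> 'a set \<Rightarrow> 'a \<Rightarrow> bool" where
  "partly_smooth_op p A M xb \<longleftrightarrow>
     Ck_submanifold_around p M xb \<and>
     usc_op A \<and>
     (\<forall>\<^sub>F x in nhds xb. A x \<noteq> {} \<and> closed (A x) \<and> convex (A x)) \<and>
     normal_space M xb = Lin (A xb) \<and>
     (\<exists>r>0. \<exists>g. (\<forall>x\<in>M \<inter> ball xb r. closest_point (tangent_space M x) ` A x = {g x}) \<and>
                 continuous_on (M \<inter> ball xb r) g) \<and>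
     (\<exists>r>0. \<forall>x\<in>M \<inter> ball xb r. continuous_op_rel A M x)"

definition resolvent_cover ::
    "('a::euclidean_space \<Rightarrow> 'a set) \<Rightarrow> 'a \<Rightarrow> real \<Rightarrow> real \<Rightarrow> 'a set \<Rightarrow> 'a set" where
  "resolvent_cover A xb \<epsilon> \<gamma> M = (\<Union>x\<in>M \<inter> ball xb \<epsilon>. {x + \<gamma> *\<^sub>R u | u. u \<in> A x})"

text \<open>The competing manifolds are of the same class as \<open>M\<close>.\<close>

definition enlarged_manifold ::
    "nat \<Rightarrow> ('a::euclidean_space \<Rightarrow> 'a set) \<Rightarrow> 'a set \<Rightarrow> 'a \<Rightarrow> 'a \<Rightarrow> real \<Rightarrow> real \<Rightarrow> 'a set \<Rightarrow> bool" where
  "enlarged_manifold p A M xb ub \<epsilon> \<gamma> Mh \<longleftrightarrow>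
     (let admissible = (\<lambda>d M'. Ck_submanifold p d M' \<and> M \<subseteq> M' \<and>
            xb + \<gamma> *\<^sub>R ub \<in> interior (resolvent_cover A xb \<epsilon> \<gamma> M'))
      in \<exists>d. admissible d Mh \<and> (\<forall>d' M'. admissible d' M' \<longrightarrow> d \<le> d'))"

definition identifiable :: "('a::euclidean_space \<Rightarrow> 'a set) \<Rightarrow> 'a set \<Rightarrow> 'a \<Rightarrow> 'a \<Rightarrow> bool" where
  "identifiable A M xb ub \<longleftrightarrow>
     xb \<in> M \<and> ub \<in> A xb \<and>
     (\<forall>X U. X \<longlonglongrightarrow> xb \<longrightarrow> (\<forall>k. U k \<in> A (X k)) \<longrightarrow> U \<longlonglongrightarrow> ub \<longrightarrow> (\<forall>\<^sub>F k in sequentially. X k \<in> M))"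

end

theory Submission
  imports Defs
begin

text \<open>The resolvent of a monotone operator is single-valued, so it suffices to show that
  \<open>x + \<gamma> A(x)\<close>, with \<open>x\<close> near \<open>xb\<close>, covers a neighbourhood of \<open>xb + \<gamma> ub\<close>: then the whole space is a
  competitor for the enlarged manifold, a competitor of least dimension exists, and each point
  \<open>X k\<close> of an identifying sequence coincides with the unique resolvent point that the cover places
  in the manifold. The covering property is a local version of Minty's theorem. Nonempty values
  near \<open>xb\<close> make \<open>A\<close> locally bounded there, and together with closed convex values and a closed
  graph this makes \<open>A\<close> locally maximal monotone.\<close>

section \<open>Solvability of monotone systems of quadratic inequalities\<close>

text \<open>With \<open>c = (v - y) / 2\<close> and \<open>s = \<langle>y, v\<rangle>\<close>, the constraint reads \<open>|x|\<^sup>2 + 2 \<langle>x, c\<rangle> - s \<le> 0\<close>. Its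
  Lagrange dual is the maximisation of \<open>- s - |c|\<^sup>2\<close> over the convex hull of the triples \<open>(y, v, s)\<close>;
  a dual optimum \<open>q\<close> gives the solution \<open>x = - c q\<close>, and monotonicity, extended bilinearly to the
  hull, makes the dual value nonpositive.\<close>

lemma finite_monotone_solvable:
  fixes G :: "('a::euclidean_space \<times> 'a) set"
  assumes fin: "finite G"
    and mono: "\<And>y v y' v'. (y, v) \<in> G \<Longrightarrow> (y', v') \<in> G \<Longrightarrow> inner (y - y') (v - v') \<ge> 0"
  shows "\<exists>x. \<forall>(y, v)\<in>G. inner (x - y) (x + v) \<le> 0"
proof (cases "G = {}")
  case False
  define H where "H = (\<lambda>(y, v). (y, v, inner y v)) ` G"
  define K where "K = convex hull H"
  have "compact K" "K \<noteq> {}" "convex K"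
    using fin False by (auto simp: K_def H_def finite_imp_compact_convex_hull)
  \<comment> \<open>On \<open>H\<close> this is \<open>inner (y - y') (v - v')\<close>, hence
    nonnegative by \<open>mono\<close>. It is affine in each argument, so the sign passes to
    \<open>K\<close> one argument at a time.\<close>
  define e where "e = (\<lambda>h k :: 'a \<times> 'a \<times> real.
    snd (snd h) + snd (snd k) - inner (fst h) (fst (snd k)) - inner (fst k) (fst (snd h)))"
  have e_commute: "e h k = e k h" for h k by (simp add: e_def)
  have "e h ((1 - b) *\<^sub>R k + b *\<^sub>R l) = (1 - b) * e h k + b * e h l" for h k l b
    by (simp add: e_def inner_simps algebra_simps)
  then have conv: "convex {k. e h k \<ge> 0}" for h
    by (auto simp: convex_alt)
  have "e h k \<ge> 0" if "h \<in> H" "k \<in> H" for h k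
    using that mono by (fastforce simp: H_def e_def inner_simps inner_commute algebra_simps)
  then have "K \<subseteq> {k. e h k \<ge> 0}" if "h \<in> H" for h
    unfolding K_def using that conv by (intro hull_minimal subsetI CollectI)
  then have "K \<subseteq> {h. e k h \<ge> 0}" if "k \<in> K" for k
    unfolding K_def
  proof (intro hull_minimal subsetI CollectI conv)
    fix h assume "h \<in> H"
    with \<open>\<And>h. h \<in> H \<Longrightarrow> K \<subseteq> {k. e h k \<ge> 0}\<close> that have "e h k \<ge> 0" by blast
    then show "e k h \<ge> 0" by (simp only: e_commute)
  qed
  then have pair: "e k k \<ge> 0" if "k \<in> K" for k using that by blast
  define c where "c k = (1/2) *\<^sub>R (fst (snd k) - fst k)" for k :: "'a \<times> 'a \<times> real"
  define s where "s k = snd (snd k)" for k :: "'a \<times> 'a \<times> real"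
  have "continuous_on K (\<lambda>k. s k + (norm (c k))\<^sup>2)"
    unfolding c_def s_def by (intro continuous_intros)
  then obtain q where "q \<in> K" and q: "\<And>k. k \<in> K \<Longrightarrow> s q + (norm (c q))\<^sup>2 \<le> s k + (norm (c k))\<^sup>2"
    using continuous_attains_inf[OF \<open>compact K\<close> \<open>K \<noteq> {}\<close>] by blast
  \<comment> \<open>The diagonal value \<open>e q q\<close> gives \<open>t \<ge> inner y v\<close>,
    and adding \<open>|v - y|^2 / 4\<close> to \<open>inner y v\<close> completes the square of
    \<open>(v + y) / 2\<close>.\<close>
  have nonneg: "s q + (norm (c q))\<^sup>2 \<ge> 0"
  proof -
    obtain y v t where qe: "q = (y, v, t)" by (cases q)
    with pair \<open>q \<in> K\<close> have "t - inner y v \<ge> 0" by (fastforce simp: e_def)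
    moreover have "inner y v + (norm (c q))\<^sup>2 = (norm ((1/2) *\<^sub>R (v + y)))\<^sup>2"
      unfolding qe c_def by (simp add: power2_norm_eq_inner inner_simps algebra_simps inner_commute)
    then have "inner y v + (norm (c q))\<^sup>2 \<ge> 0" by simp
    ultimately show ?thesis by (simp add: s_def qe)
  qed
  \<comment> \<open>First-order optimality of \<open>q\<close>: move from \<open>q\<close> towards
    \<open>k\<close> by a fraction \<open>t\<close>, divide by \<open>t\<close> and let
    \<open>t\<close> tend to 0.\<close>
  have opt: "s k - s q + 2 * inner (c q) (c k - c q) \<ge> 0" if "k \<in> K" for k
  proof -
    have "0 \<le> s k - s q + 2 * inner (c q) (c k - c q) + t * (norm (c k - c q))\<^sup>2" if "0 < t" "t \<le> 1" for t
    proof -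
      have "(1 - t) *\<^sub>R q + t *\<^sub>R k \<in> K"
        using \<open>convex K\<close> \<open>q \<in> K\<close> \<open>k \<in> K\<close> that by (simp add: convex_alt)
      from q[OF this] have "s q + (norm (c q))\<^sup>2 \<le> s q + t * (s k - s q) + (norm (c q + t *\<^sub>R (c k - c q)))\<^sup>2"
        by (simp add: s_def c_def algebra_simps)
      also have "\<dots> = s q + (norm (c q))\<^sup>2 + t * (s k - s q + 2 * inner (c q) (c k - c q) + t * (norm (c k - c q))\<^sup>2)"
        unfolding power2_norm_eq_inner by (simp add: inner_simps algebra_simps inner_commute)
      finally show ?thesis using that by (simp add: zero_le_mult_iff)
    qed
    then have "\<forall>\<^sub>F t in at_right 0. 0 \<le> s k - s q + 2 * inner (c q) (c k - c q) + t * (norm (c k - c q))\<^sup>2"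
      unfolding eventually_at_right_field by (intro exI[of _ 1]) auto
    moreover have "((\<lambda>t. s k - s q + 2 * inner (c q) (c k - c q) + t * (norm (c k - c q))\<^sup>2) \<longlongrightarrow>
        s k - s q + 2 * inner (c q) (c k - c q) + 0 * (norm (c k - c q))\<^sup>2) (at_right 0)"
      by (intro tendsto_intros)
    ultimately show ?thesis
      using tendsto_lowerbound[OF _ _ trivial_limit_at_right_real] by fastforce
  qed
  have "inner (- c q - y) (- c q + v) \<le> 0" if "(y, v) \<in> G" for y v
  proof -
    have "(y, v, inner y v) \<in> K"
      using that hull_subset[of H convex] by (force simp: K_def H_def)
    from opt[OF this] have "0 \<le> inner y v - s q + 2 * inner (c q) ((1/2) *\<^sub>R (v - y) - c q)"
      by (simp add: s_def c_def [of "(y, v, inner y v)"])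
    \<comment> \<open>Adding the nonnegative optimal value removes \<open>s q\<close>; what remains
      is minus the left-hand side of the constraint at \<open>- c q\<close>.\<close>
    with nonneg have "0 \<le> inner y v + inner (c q) (v - y) - inner (c q) (c q)"
      by (simp add: power2_norm_eq_inner inner_diff_right diff_divide_distrib)
    then show ?thesis by (simp add: inner_simps algebra_simps inner_commute)
  qed
  then show ?thesis by blast
qed auto

text \<open>For every parameter, the constraint coming from a single point of the graph already confines
  the solutions to a ball, so finitely many constraints suffice by compactness.\<close>

lemma monotone_solvable:
  fixes G :: "('a::euclidean_space \<times> 'a) set"
  assumes mono: "\<And>y v y' v'. (y, v) \<in> G \<Longrightarrow> (y', v') \<in> G \<Longrightarrow> inner (y - y') (v - v') \<ge> 0"
  shows "\<exists>x. \<forall>(y, v)\<in>G. inner (x - y) (x + v - z) \<le> 0"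
proof (cases "G = {}")
  case False
  then obtain y0 v0 where g0: "(y0, v0) \<in> G" by auto
  define C where "C = (\<lambda>(y, v). {x. inner (x - y) (x + v - z) \<le> 0})"
  have closed: "closed (C g)" for g
    unfolding C_def by (cases g) (auto intro!: closed_Collect_le continuous_intros)
  have sub: "C (y0, v0) \<subseteq> cball y0 (norm (z - v0 - y0))"
  proof
    fix x assume "x \<in> C (y0, v0)"
    then have "(norm (x - y0))\<^sup>2 \<le> inner (x - y0) (z - v0 - y0)"
      by (simp add: C_def power2_norm_eq_inner inner_simps algebra_simps)
    also have "\<dots> \<le> norm (x - y0) * norm (z - v0 - y0)" by (rule norm_cauchy_schwarz)
    finally have "norm (x - y0) \<le> norm (z - v0 - y0)"
      by (cases "x = y0") (auto simp: power2_eq_square)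
    then show "x \<in> cball y0 (norm (z - v0 - y0))" by (simp add: dist_norm norm_minus_commute)
  qed
  have comp: "compact (C (y0, v0))"
    using sub closed by (meson bounded_cball bounded_subset compact_eq_bounded_closed)
  have "C (y0, v0) \<inter> \<Inter> (C ` G) \<noteq> {}"
  proof (rule compact_imp_fip[OF comp])
    fix F assume "finite F" "F \<subseteq> C ` G"
    then obtain G' where G': "G' \<subseteq> G" "finite G'" "F = C ` G'" by (meson finite_subset_image)
    \<comment> \<open>The shift of \<open>v\<close> to \<open>v - z\<close> absorbs the parameter
      and keeps differences, hence monotonicity.\<close>
    have "\<exists>x. \<forall>(y, w)\<in>(\<lambda>(y, v). (y, v - z)) ` insert (y0, v0) G'. inner (x - y) (x + w) \<le> 0"
    proof (rule finite_monotone_solvable)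
      fix y v y' v'
      assume "(y, v) \<in> (\<lambda>(y, v). (y, v - z)) ` insert (y0, v0) G'"
        "(y', v') \<in> (\<lambda>(y, v). (y, v - z)) ` insert (y0, v0) G'"
      then have "(y, v + z) \<in> G" "(y', v' + z) \<in> G" using G'(1) g0 by auto
      from mono[OF this] show "inner (y - y') (v - v') \<ge> 0" by simp
    qed (use G'(2) in simp)
    then show "C (y0, v0) \<inter> \<Inter> F \<noteq> {}"
      unfolding G' C_def by (fastforce simp: algebra_simps)
  qed (use closed in auto)
  then show ?thesis by (auto simp: C_def)
qed auto

section \<open>Local boundedness and local maximality\<close>

text \<open>Monotonicity against one fixed value at each of the finitely many points
  \<open>x + \<rho> *\<^sub>R b\<close>, with \<open>b\<close> a signed basis vector, bounds every
  coordinate of \<open>v\<close> by a constant plus a small multiple of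
  \<open>norm v\<close>.\<close>

lemma monotone_op_locally_bounded:
  fixes A :: "'a::euclidean_space \<Rightarrow> 'a set"
  assumes mono: "monotone_op_on A S" and "open S" "x \<in> S"
    and ne: "\<And>y. y \<in> S \<Longrightarrow> A y \<noteq> {}"
  shows "\<exists>\<delta>>0. bounded (\<Union>y\<in>ball x \<delta>. A y)"
proof -
  obtain e where e: "e > 0" "ball x e \<subseteq> S"
    using \<open>open S\<close> \<open>x \<in> S\<close> open_contains_ball by blast
  define \<rho> where "\<rho> = e / 2"
  have \<rho>: "\<rho> > 0" "\<rho> < e" using e by (auto simp: \<rho>_def)
  define B :: "'a set" where "B = Basis \<union> uminus ` Basis"
  have "finite B" by (simp add: B_def)
  have Bn: "norm b = 1" if "b \<in> B" for b using that by (auto simp: B_def)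
  have inS: "x + \<rho> *\<^sub>R b \<in> S" if "b \<in> B" for b
    using e(2) \<rho> Bn[OF that] by (auto simp: dist_norm subset_iff)
  then have "\<forall>b\<in>B. \<exists>u. u \<in> A (x + \<rho> *\<^sub>R b)" using ne by blast
  then obtain f where f: "\<And>b. b \<in> B \<Longrightarrow> f b \<in> A (x + \<rho> *\<^sub>R b)" by metis
  define N where "N = real DIM('a)"
  have N: "N \<ge> 1" by (simp add: N_def Suc_leI)
  \<comment> \<open>After summation over the \<open>N\<close> coordinates the error
    \<open>N * \<delta> * norm v\<close> is half of \<open>\<rho> * norm v\<close> and can be
    absorbed.\<close>
  define \<delta> where "\<delta> = \<rho> / (2 * N)"
  have \<delta>: "\<delta> > 0" "\<delta> \<le> \<rho>" using \<rho> N by (auto simp: \<delta>_def field_simps)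
  define R where "R = (\<Sum>b\<in>B. norm (f b))"
  have R: "norm (f b) \<le> R" if "b \<in> B" for b
    unfolding R_def using that \<open>finite B\<close> by (intro member_le_sum) auto
  have bound: "norm v \<le> 2 * N * (2 * \<rho> * R) / \<rho>" if "y \<in> ball x \<delta>" "v \<in> A y" for y v
  proof -
    have yS: "y \<in> S" and yx: "norm (x - y) \<le> \<delta>"
      using that(1) \<delta> \<rho> e(2) by (auto simp: dist_norm subset_iff)
    have up: "\<rho> * inner b v \<le> 2 * \<rho> * R + \<delta> * norm v" if "b \<in> B" for b
    proof -
      have "inner (x + \<rho> *\<^sub>R b - y) (f b - v) \<ge> 0"
        using mono inS[OF that] yS f[OF that] \<open>v \<in> A y\<close> by (auto simp: monotone_op_on_def)
      then have "\<rho> * inner b v \<le> inner (x + \<rho> *\<^sub>R b - y) (f b) + inner (y - x) v"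
        by (simp add: inner_simps algebra_simps)
      also have "inner (x + \<rho> *\<^sub>R b - y) (f b) \<le> norm (x + \<rho> *\<^sub>R b - y) * norm (f b)"
        by (rule norm_cauchy_schwarz)
      also have "\<dots> \<le> (2 * \<rho>) * R"
      proof (rule mult_mono)
        have "norm (x + \<rho> *\<^sub>R b - y) \<le> norm (x - y) + norm (\<rho> *\<^sub>R b)"
          by (metis add_diff_eq diff_add_eq norm_triangle_ineq)
        then show "norm (x + \<rho> *\<^sub>R b - y) \<le> 2 * \<rho>" using yx \<delta> \<rho> Bn[OF that] by simp
      qed (use R[OF that] \<rho> in auto)
      also have "inner (y - x) v \<le> norm (y - x) * norm v" by (rule norm_cauchy_schwarz)
      also have "\<dots> \<le> \<delta> * norm v" using yx by (intro mult_right_mono) (auto simp: norm_minus_commute)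
      finally show ?thesis by simp
    qed
    have "\<rho> * \<bar>inner v b\<bar> \<le> 2 * \<rho> * R + \<delta> * norm v" if "b \<in> Basis" for b
      using up[of b] up[of "- b"] that by (auto simp: B_def abs_if inner_commute)
    then have "(\<Sum>b\<in>Basis. \<rho> * \<bar>inner v b\<bar>) \<le> (\<Sum>b\<in>(Basis :: 'a set). 2 * \<rho> * R + \<delta> * norm v)"
      by (intro sum_mono) auto
    then have "\<rho> * (\<Sum>b\<in>Basis. \<bar>inner v b\<bar>) \<le> N * (2 * \<rho> * R + \<delta> * norm v)"
      by (simp add: sum_distrib_left N_def)
    moreover have "\<rho> * norm v \<le> \<rho> * (\<Sum>b\<in>Basis. \<bar>inner v b\<bar>)"
      using \<rho> norm_le_l1 by (intro mult_left_mono) auto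
    moreover have "N * (\<delta> * norm v) = \<rho> * norm v / 2"
      using N by (simp add: \<delta>_def)
    ultimately have "\<rho> * norm v \<le> 2 * N * (2 * \<rho> * R)" by (simp add: algebra_simps)
    then show ?thesis using \<rho> by (simp add: field_simps)
  qed
  then have "bounded (\<Union>y\<in>ball x \<delta>. A y)" unfolding bounded_iff by blast
  with \<delta>(1) show ?thesis by blast
qed

text \<open>A point \<open>w\<close> outside \<open>A x\<close> is strictly separated from it by
  some \<open>h\<close>. Values of \<open>A\<close> at points approaching \<open>x\<close> along
  \<open>- h\<close> stay on the side of \<open>w\<close>; by local boundedness they accumulate, and
  the closed graph puts the limit in \<open>A x\<close>.\<close>

lemma monotone_op_maximal:
  fixes A :: "'a::euclidean_space \<Rightarrow> 'a set"
  assumes mono: "monotone_op_on A S" and S: "open S" "x \<in> S"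
    and ne: "\<And>y. y \<in> S \<Longrightarrow> A y \<noteq> {}"
    and "closed (A x)" "convex (A x)" and usc: "usc_op_rel A UNIV x"
    and rel: "\<And>y v. y \<in> S \<Longrightarrow> v \<in> A y \<Longrightarrow> inner (y - x) (v - w) \<ge> 0"
  shows "w \<in> A x"
proof (rule ccontr)
  assume "w \<notin> A x"
  then obtain h b where h: "inner h w < b" "\<forall>v\<in>A x. inner h v > b"
    using separating_hyperplane_closed_point[OF \<open>convex (A x)\<close> \<open>closed (A x)\<close>] by blast
  obtain \<delta> where \<delta>: "\<delta> > 0" "bounded (\<Union>y\<in>ball x \<delta>. A y)"
    using monotone_op_locally_bounded[OF mono S ne] by blast
  \<comment> \<open>With \<open>X k - x\<close> a negative multiple of \<open>h\<close>,
    \<open>rel\<close> turns into \<open>inner h v \<le> inner h w\<close> for the values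
    \<open>v\<close> at \<open>X k\<close>.\<close>
  define X where "X = (\<lambda>k. x - (1 / real (Suc k)) *\<^sub>R h)"
  have "X \<longlonglongrightarrow> x - 0 *\<^sub>R h"
    unfolding X_def by (intro tendsto_intros LIMSEQ_Suc[OF lim_1_over_n])
  then have X: "X \<longlonglongrightarrow> x" by simp
  have "open (S \<inter> ball x \<delta>)" "x \<in> S \<inter> ball x \<delta>" using S \<delta> by auto
  then have "\<forall>\<^sub>F k in sequentially. X k \<in> S \<inter> ball x \<delta>" by (rule topological_tendstoD[OF X])
  then obtain k0 where k0: "\<And>k. k \<ge> k0 \<Longrightarrow> X k \<in> S \<inter> ball x \<delta>"
    unfolding eventually_sequentially by blast
  define Y where "Y = (\<lambda>k. X (k + k0))"
  have Y: "Y \<longlonglongrightarrow> x" unfolding Y_def by (rule LIMSEQ_ignore_initial_segment[OF X])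
  have YS: "Y k \<in> S \<inter> ball x \<delta>" for k unfolding Y_def by (rule k0) simp
  have "\<forall>k. \<exists>v. v \<in> A (Y k)" using ne YS by blast
  then obtain V where V: "\<And>k. V k \<in> A (Y k)" by metis
  have le: "inner h (V k) \<le> inner h w" for k
  proof -
    have "inner (Y k - x) (V k - w) \<ge> 0" using rel YS V by blast
    then have "0 \<le> - (1 / real (Suc (k + k0))) * inner h (V k - w)" by (simp add: Y_def X_def)
    then show ?thesis by (simp add: zero_le_mult_iff inner_diff_right divide_le_0_iff)
  qed
  have "range V \<subseteq> (\<Union>y\<in>ball x \<delta>. A y)" using V YS by blast
  then have "bounded (range V)" using \<delta>(2) bounded_subset by blast
  then obtain v \<sigma> where \<sigma>: "strict_mono \<sigma>" "(V \<circ> \<sigma>) \<longlonglongrightarrow> v"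
    using bounded_imp_convergent_subsequence[of V] by blast
  have "(Y \<circ> \<sigma>) \<longlonglongrightarrow> x" by (rule LIMSEQ_subseq_LIMSEQ[OF Y \<sigma>(1)])
  then have "v \<in> A x"
    using usc[unfolded usc_op_rel_def, rule_format, of "Y \<circ> \<sigma>" "V \<circ> \<sigma>" v] \<sigma>(2) V by simp
  have "(\<lambda>k. inner h ((V \<circ> \<sigma>) k)) \<longlonglongrightarrow> inner h v" using \<sigma>(2) by (intro tendsto_intros)
  then have "inner h v \<le> inner h w" by (rule LIMSEQ_le_const2) (use le in auto)
  with h \<open>v \<in> A x\<close> show False by fastforce
qed

section \<open>Existence and uniqueness of resolvent points\<close>

text \<open>The local form of Minty's theorem. The solution of the inequality system could a priori
  leave the ball; the constraint at \<open>(xb, ub)\<close> prevents this, so that maximality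
  applies at it.\<close>

lemma monotone_op_local_resolvent:
  fixes A :: "'a::euclidean_space \<Rightarrow> 'a set"
  assumes mono: "monotone_op_on A (ball xb r)" and "ub \<in> A xb" and "\<gamma> > 0"
    and reg: "\<And>x. x \<in> ball xb r \<Longrightarrow> A x \<noteq> {} \<and> closed (A x) \<and> convex (A x) \<and> usc_op_rel A UNIV x"
    and z: "z \<in> ball (xb + \<gamma> *\<^sub>R ub) r"
  shows "\<exists>x\<in>ball xb r. \<exists>u\<in>A x. z = x + \<gamma> *\<^sub>R u"
proof -
  define G where "G = {(y, \<gamma> *\<^sub>R u) | y u. y \<in> ball xb r \<and> u \<in> A y}"
  have "inner (y - y') (v - v') \<ge> 0" if g: "(y, v) \<in> G" "(y', v') \<in> G" for y v y' v'
  proof -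
    obtain u u' where u: "y \<in> ball xb r" "u \<in> A y" "v = \<gamma> *\<^sub>R u" "y' \<in> ball xb r" "u' \<in> A y'" "v' = \<gamma> *\<^sub>R u'"
      using g unfolding G_def by blast
    then have "inner (y - y') (u - u') \<ge> 0" using mono unfolding monotone_op_on_def by blast
    moreover have "inner (y - y') (v - v') = \<gamma> * inner (y - y') (u - u')"
      by (simp add: u inner_simps algebra_simps)
    ultimately show ?thesis using \<open>\<gamma> > 0\<close> by simp
  qed
  from monotone_solvable[OF this] obtain x where "\<forall>(y, v)\<in>G. inner (x - y) (x + v - z) \<le> 0" by blast
  then have x: "inner (x - y) (x + \<gamma> *\<^sub>R u - z) \<le> 0" if "y \<in> ball xb r" "u \<in> A y" for y u
    using that unfolding G_def by blast
  \<comment> \<open>The constraint at \<open>(xb, ub)\<close> yields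
    \<open>norm (x - xb) \<le> norm e\<close>, the nonexpansiveness of the resolvent, so one radius
    \<open>r\<close> serves for both balls.\<close>
  define e where "e = z - (xb + \<gamma> *\<^sub>R ub)"
  have e: "norm e < r" using z by (simp add: e_def dist_norm norm_minus_commute)
  then have "xb \<in> ball xb r" using norm_ge_zero[of e] by (simp del: norm_ge_zero)
  with x \<open>ub \<in> A xb\<close> have "inner (x - xb) (x - xb - e) \<le> 0"
    unfolding e_def by (fastforce simp: algebra_simps)
  then have "(norm (x - xb))\<^sup>2 \<le> inner (x - xb) e" by (simp add: power2_norm_eq_inner inner_diff_right)
  also have "\<dots> \<le> norm (x - xb) * norm e" by (rule norm_cauchy_schwarz)
  finally have "norm (x - xb) \<le> norm e" by (cases "x = xb") (auto simp: power2_eq_square)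
  with e have xr: "x \<in> ball xb r" by (simp add: dist_norm norm_minus_commute)
  \<comment> \<open>The value forced by the equation for \<open>z\<close>. The system says exactly
    that \<open>(x, w)\<close> is monotonically related to the graph over the ball.\<close>
  define w where "w = (1 / \<gamma>) *\<^sub>R (z - x)"
  have zw: "z = x + \<gamma> *\<^sub>R w" using \<open>\<gamma> > 0\<close> by (simp add: w_def)
  have "inner (y - x) (v - w) \<ge> 0" if "y \<in> ball xb r" "v \<in> A y" for y v
  proof -
    have "inner (x - y) (x + \<gamma> *\<^sub>R v - z) = - (\<gamma> * inner (y - x) (v - w))"
      by (simp add: zw inner_simps algebra_simps)
    with x[OF that] \<open>\<gamma> > 0\<close> show ?thesis by (simp add: zero_le_mult_iff)
  qed
  then have "w \<in> A x"
    using monotone_op_maximal[OF mono open_ball xr] reg xr by blast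
  with xr zw show ?thesis by blast
qed

text \<open>Pairing \<open>x - y = \<gamma> *\<^sub>R (v - u)\<close> with \<open>x - y\<close>
  makes the squared distance nonpositive.\<close>

lemma monotone_resolvent_unique:
  assumes "monotone_op_on A S" "x \<in> S" "y \<in> S" "u \<in> A x" "v \<in> A y" "\<gamma> > 0"
    and "x + \<gamma> *\<^sub>R u = y + \<gamma> *\<^sub>R v"
  shows "x = y"
proof -
  have "x - y = \<gamma> *\<^sub>R (v - u)" using assms(7) by (simp add: algebra_simps)
  then have "inner (x - y) (x - y) = - (\<gamma> * inner (x - y) (u - v))"
    by (metis inner_minus_right inner_scaleR_right minus_diff_eq mult_minus_right)
  moreover have "inner (x - y) (u - v) \<ge> 0" using assms unfolding monotone_op_on_def by blast
  ultimately have "inner (x - y) (x - y) \<le> 0" using \<open>\<gamma> > 0\<close> by simp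
  then show ?thesis by (metis antisym inner_eq_zero_iff inner_ge_zero right_minus_eq)
qed

section \<open>The whole space as a competing manifold\<close>

lemma Ck_on_const: "Ck_on k (\<lambda>x. c) S"
  by (induction k arbitrary: c) auto

lemma Ck_on_ident: "Ck_on k (\<lambda>x. x) S"
  by (cases k) (auto simp: Ck_on_const continuous_on_id)

lemma Ck_submanifold_UNIV: "Ck_submanifold p DIM('a) (UNIV :: 'a::euclidean_space set)"
  unfolding Ck_submanifold_def
proof
  fix x :: 'a
  show "\<exists>U V \<phi> \<psi> (L :: 'a set). open U \<and> x \<in> U \<and> open V \<and> homeomorphism U V \<phi> \<psi> \<and>
      Ck_on p \<phi> U \<and> Ck_on p \<psi> V \<and> subspace L \<and> dim L = DIM('a) \<and> \<phi> ` (UNIV \<inter> U) = V \<inter> L"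
    by (rule exI[of _ UNIV], rule exI[of _ UNIV], rule exI[of _ "\<lambda>x. x"], rule exI[of _ "\<lambda>x. x"],
        rule exI[of _ UNIV]) (auto simp: Ck_on_ident homeomorphism_ident)
qed

section \<open>Minimal dimension, span and identifiability\<close>

theorem corollary2:
  fixes A :: "real ^ 'n \<Rightarrow> (real ^ 'n) set"
    and M :: "(real ^ 'n) set"
    and xb ub :: "real ^ 'n"
    and p d :: nat
    and \<gamma> \<epsilon> :: real
  assumes "p \<ge> 1"
    and "Ck_submanifold p d M"
    and "locally_monotone_op A xb"
    and "partly_smooth_op p A M xb"
    and "ub \<in> rel_frontier (A xb)"
    and "\<gamma> > 0"
    and "\<epsilon> > 0"
    and "monotone_op_on A (ball xb \<epsilon>)"
  shows "\<exists>Mh. enlarged_manifold p A M xb ub \<epsilon> \<gamma> Mh \<and>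
           span (resolvent_cover A xb \<epsilon> \<gamma> Mh) = UNIV \<and>
           (continuous_op_rel A Mh xb \<longrightarrow> identifiable A Mh xb ub)"
proof -
  have usc: "usc_op A" and "xb \<in> M"
    and "\<forall>\<^sub>F x in nhds xb. A x \<noteq> {} \<and> closed (A x) \<and> convex (A x)"
    using assms(4) by (auto simp: partly_smooth_op_def Ck_submanifold_around_def)
  then obtain r0 where r0: "r0 > 0"
    "\<And>x. x \<in> ball xb r0 \<Longrightarrow> A x \<noteq> {} \<and> closed (A x) \<and> convex (A x)"
    unfolding eventually_nhds_metric by (auto simp: dist_commute)
  \<comment> \<open>Regular values are available within \<open>r0\<close>, monotonicity within
    \<open>\<epsilon>\<close>; \<open>r \<le> \<epsilon>\<close> also keeps the resolvent points
    inside the ball used by the cover.\<close>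
  define r where "r = min r0 \<epsilon>"
  have r: "r > 0" using r0 assms(7) by (simp add: r_def)
  \<comment> \<open>A closed set contains its relative frontier.\<close>
  have "closed (A xb)" using r0 by simp
  then have ub: "ub \<in> A xb" using assms(5) by (auto simp: rel_frontier_def)
  have mono: "monotone_op_on A (ball xb r)"
    using assms(8) by (simp add: monotone_op_on_def r_def)
  have reg: "A x \<noteq> {} \<and> closed (A x) \<and> convex (A x) \<and> usc_op_rel A UNIV x" if "x \<in> ball xb r" for x
    using usc r0(2)[of x] that unfolding usc_op_def op_dom_def r_def by simp
  define adm where "adm = (\<lambda>d M'. Ck_submanifold p d M' \<and> M \<subseteq> M' \<and>
            xb + \<gamma> *\<^sub>R ub \<in> interior (resolvent_cover A xb \<epsilon> \<gamma> M'))"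
  have "ball (xb + \<gamma> *\<^sub>R ub) r \<subseteq> resolvent_cover A xb \<epsilon> \<gamma> UNIV"
  proof
    fix z assume "z \<in> ball (xb + \<gamma> *\<^sub>R ub) r"
    then obtain x u where "x \<in> ball xb r" "u \<in> A x" "z = x + \<gamma> *\<^sub>R u"
      using monotone_op_local_resolvent[OF mono ub assms(6) reg] by blast
    moreover from this have "x \<in> ball xb \<epsilon>" by (simp add: r_def)
    ultimately show "z \<in> resolvent_cover A xb \<epsilon> \<gamma> UNIV" unfolding resolvent_cover_def by blast
  qed
  then have "xb + \<gamma> *\<^sub>R ub \<in> interior (resolvent_cover A xb \<epsilon> \<gamma> UNIV)"
    using r by (meson centre_in_ball interiorI open_ball)
  then have ex: "\<exists>d M'. adm d M'" unfolding adm_def using Ck_submanifold_UNIV by blast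
  define dm where "dm = (LEAST d. \<exists>M'. adm d M')"
  obtain Mh where Mh: "adm dm Mh" using LeastI_ex[OF ex] unfolding dm_def by blast
  have "dm \<le> d'" if "adm d' M'" for d' M'
    unfolding dm_def by (rule Least_le) (use that in blast)
  then have "enlarged_manifold p A M xb ub \<epsilon> \<gamma> Mh"
    unfolding enlarged_manifold_def Let_def adm_def[symmetric] using Mh by blast
  moreover have int: "xb + \<gamma> *\<^sub>R ub \<in> interior (resolvent_cover A xb \<epsilon> \<gamma> Mh)" and "M \<subseteq> Mh"
    using Mh by (auto simp: adm_def)
  \<comment> \<open>A set with nonempty interior has the whole space as affine hull, and the span
    contains that hull.\<close>
  have "span (resolvent_cover A xb \<epsilon> \<gamma> Mh) = UNIV"
    using affine_hull_nonempty_interior[of "resolvent_cover A xb \<epsilon> \<gamma> Mh"] int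
      affine_hull_subset_span[of "resolvent_cover A xb \<epsilon> \<gamma> Mh"] by blast
  moreover have "identifiable A Mh xb ub"
    unfolding identifiable_def
  proof (intro conjI allI impI)
    fix X U
    assume X: "X \<longlonglongrightarrow> xb" and U: "\<forall>k. U k \<in> A (X k)" "U \<longlonglongrightarrow> ub"
    have "(\<lambda>k. X k + \<gamma> *\<^sub>R U k) \<longlonglongrightarrow> xb + \<gamma> *\<^sub>R ub" using X U(2) by (intro tendsto_intros)
    then have "\<forall>\<^sub>F k in sequentially. X k + \<gamma> *\<^sub>R U k \<in> interior (resolvent_cover A xb \<epsilon> \<gamma> Mh)"
      using int topological_tendstoD open_interior by blast
    \<comment> \<open>Uniqueness of the resolvent point holds only inside the ball of monotonicity,
      so \<open>X k\<close> has to lie there as well as the point given by the cover.\<close>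
    moreover have "\<forall>\<^sub>F k in sequentially. X k \<in> ball xb \<epsilon>"
      using X topological_tendstoD[OF X open_ball] assms(7) by simp
    ultimately show "\<forall>\<^sub>F k in sequentially. X k \<in> Mh"
    proof eventually_elim
      case (elim k)
      then have "X k + \<gamma> *\<^sub>R U k \<in> resolvent_cover A xb \<epsilon> \<gamma> Mh" using interior_subset by blast
      then obtain y v where "y \<in> Mh" "y \<in> ball xb \<epsilon>" "v \<in> A y" "X k + \<gamma> *\<^sub>R U k = y + \<gamma> *\<^sub>R v"
        unfolding resolvent_cover_def by blast
      moreover from this have "X k = y"
        using monotone_resolvent_unique[OF assms(8) elim(2) _ _ _ assms(6)] U(1) by blast
      ultimately show "X k \<in> Mh" by simp
    qed
  qed (use ub \<open>xb \<in> M\<close> \<open>M \<subseteq> Mh\<close> in auto)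
  ultimately show ?thesis by blast
qed

end
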